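(* Let $p\in[1,\infty)$, $q\in[1,\infty]$ with $\frac1p+\frac1q=1$. Let $A\in\mathbf{R}^{m\times n}$ have unit $\ell_2$-norm columns, let $x^*\in\mathbf{R}^n$ with $\|x^*\|_0=k^*$, let $\epsilon\in\mathbf{R}^m$, and $b=Ax^*+\epsilon$. Let $\{x^{(t)}\}_{t\ge0}$ be a sequence generated by the AIT algorithm with sparsity level $k$, step size $s>0$, an initial point $x^{(0)}\in\mathbf{R}^n$, and a defining function with boundedness parameters $0\le c_2\le c_1\le1$. Put $$L_1=2^{p-1}(k^* )^{\max\{1-\frac pq,0\}}+\bigl(2^{p-1}-(c_2)^p+1\bigr)k^*,$$ $$L_2=2^{p}(2k^* )^{\max\{1-\frac pq,0\}}+2^{p-1}(c_1)^pk^*,\qquad L=\min\{\sqrt[p]{L_1},\sqrt[p]{L_2}\}.$$ Assume that the generalized restricted isometry constant of $A$ satisfies $\beta_{3k^*+1,p,q}<\frac1L$, and that (i) $k=k^*$; (ii) $\underline{s}<s<\overline{s}$, where $$\underline{s}=\frac{(2k^* )^{\max\{\frac1q-\frac1p,0\}}-\frac1L}{(2k^* )^{\max\{\frac1q-\frac1p,0\}}-\beta_{3k^*+1,p,q}},\qquad \overline{s}=\frac{(2k^* )^{\max\{\frac1q-\frac1p,0\}}+\frac1L}{(2k^* )^{\max\{\frac1q-\frac1p,0\}}+\beta_{3k^*+1,p,q}}.$$ Then, with $\gamma_s=|1-s|(2k^* )^{\max\{\frac1q-\frac1p,0\}}+s\,\beta_{3k^*+1,p,q}$ and $\rho_s=\gamma_sL$,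 one has $\rho_s<1$ and for all $t$ $$\|x^{(t)}-x^*\|_p\le(\rho_s)^t\|x^*-x^{(0)}\|_p+\frac{sL}{1-\rho_s}\|A^T\epsilon\|_q.$$ In particular, when $\epsilon=0$, $\|x^{(t)}-x^*\|_p\le(\rho_s)^t\|x^*-x^{(0)}\|_p$.
   Context: $\|x\|_0$ is the number of nonzero components of $x$; $\|\cdot\|_p$ is the $\ell_p$ norm; conventions $1/\infty=0$ and $p/\infty=0$. Generalized restricted isometry constant (gRIC): for a positive integer $r$ and $p\in[1,\infty)$, $q\in[1,\infty]$ with $\frac1p+\frac1q=1$, $$\beta_{r,p,q}=\sup_{S\subset\{1,\dots,n\},\,|S|\le r}\ \sup_{x\in\mathbf{R}^{|S|}\setminus\{0\}}\frac{\|(\mathbf{I}_{|S|}-A_S^TA_S)x\|_q}{\|x\|_p},$$ where $A_S$ is the submatrix of $A$ formed by the columns indexed by $S$ and $\mathbf{I}_r$ is the $r\times r$ identity. Defining function: a family of real functions $f_\tau(u)$ (threshold $\tau\ge0$, defined for $|u|\ge\tau$) such that (1) $f_\tau$ is odd; (2) $f_\tau(u)<f_\tau(v)$ whenever $\tau\le u<v$; (3) there are constants $0\le c_2\le c_1\le1$ (the boundedness parameters) with $u-c_1\tau\le f_\tau(u)\le u-c_2\tau$ for all $u\ge\tau$. AIT (adaptively iterative thresholding) algorithm: given $A\in\mathbf{R}^{m\times n}$ with unit $\ell_2$-norm columns, $b\in\mathbf{R}^m$, a sparsity level $k$ (with $1\le k<n$), a step size $s>0$ and an initial point $x^{(0)}\in\mathbf{R}^n$,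 for $t=0,1,2,\dots$: set $z^{(t+1)}=x^{(t)}-sA^T(Ax^{(t)}-b)$; let $I^{t+1}$ be the index set of the $k$ largest components of $z^{(t+1)}$ in magnitude and let $\tau^{(t+1)}=|z^{(t+1)}_{[k+1]}|$, where $[k+1]$ is the index of the $(k+1)$-th largest component of $z^{(t+1)}$ in magnitude (ties broken arbitrarily, $[k+1]\notin I^{t+1}$); set $x^{(t+1)}_i=f_{\tau^{(t+1)}}(z^{(t+1)}_i)$ for $i\in I^{t+1}$ and $x^{(t+1)}_i=0$ otherwise.
   Formalization: For p > 1 the initial point x^(0) is additionally assumed to have at most k nonzero components; for p > 1 the claim fails for arbitrary dense x^(0) (e.g. p=q=2, k=1, n=101, A a multiple of I−J/n, x^(0)=x*+(1,...,1)). For p = 1 the initial point stays arbitrary. *)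

theory Defs
  imports "HOL-Analysis.Analysis"
begin

text \<open>The \<open>\<ell>\<^sub>q\<close> norm of the vector \<open>(v i)\<^sub>i\<close> with \<open>i\<close> ranging over a finite index set \<open>S\<close>,
  for \<open>1 \<le> q \<le> \<infinity>\<close>. Values of \<open>v\<close> outside \<open>S\<close> are irrelevant, so \<open>\<real>\<^bsup>|S|\<^esup>\<close> is represented
  by functions restricted to \<open>S\<close>. The \<open>0\<close> inserted in the maximum only matters if \<open>S = {}\<close>.\<close>

definition lp_norm_on :: "ereal \<Rightarrow> 'i set \<Rightarrow> ('i \<Rightarrow> real) \<Rightarrow> real" where
  "lp_norm_on q S v =
     (if q = \<infinity> then Max (insert 0 ((\<lambda>i. \<bar>v i\<bar>) ` S))
      else (\<Sum>i\<in>S. \<bar>v i\<bar> powr real_of_ereal q) powr (1 / real_of_ereal q))"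

definition lp_norm :: "ereal \<Rightarrow> real ^ 'n \<Rightarrow> real" where
  "lp_norm q x = lp_norm_on q UNIV (\<lambda>i. x $ i)"

definition l0_norm :: "real ^ 'n \<Rightarrow> nat" where
  "l0_norm x = card {i. x $ i \<noteq> 0}"

text \<open>\<open>A\<^sub>S x\<close> and \<open>A\<^sub>S\<^sup>T y\<close>, the latter to be read on indices in \<open>S\<close> only.\<close>

definition submat_mult :: "real ^ 'n ^ 'm \<Rightarrow> 'n set \<Rightarrow> ('n \<Rightarrow> real) \<Rightarrow> real ^ 'm" where
  "submat_mult A S x = (\<Sum>j\<in>S. x j *\<^sub>R column j A)"

definition submat_transpose_mult :: "real ^ 'n ^ 'm \<Rightarrow> real ^ 'm \<Rightarrow> 'n \<Rightarrow> real" where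
  "submat_transpose_mult A y = (\<lambda>i. column i A \<bullet> y)"

text \<open>The two suprema of the generalized restricted isometry constant are merged into one over
  pairs \<open>(S, x)\<close>; the empty \<open>S\<close> contributes nothing, since \<open>\<real>\<^sup>0\<close> has no nonzero vector. For
  \<open>r \<ge> 1\<close> the set is nonempty and bounded above, so the real-valued \<open>Sup\<close> is meaningful.\<close>

definition gRIC :: "real ^ 'n ^ 'm \<Rightarrow> nat \<Rightarrow> real \<Rightarrow> ereal \<Rightarrow> real" where
  "gRIC A r p q =
     Sup {lp_norm_on q S (\<lambda>i. x i - submat_transpose_mult A (submat_mult A S x) i)
            / lp_norm_on (ereal p) S x
          | S x. card S \<le> r \<and> (\<exists>i\<in>S. x i \<noteq> 0)}"

text \<open>\<open>f \<tau> u\<close> is \<open>f\<^sub>\<tau>(u)\<close>; the values for \<open>\<bar>u\<bar> < \<tau>\<close> are unconstrained.\<close>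

definition defining_function :: "(real \<Rightarrow> real \<Rightarrow> real) \<Rightarrow> real \<Rightarrow> real \<Rightarrow> bool" where
  "defining_function f c1 c2 \<longleftrightarrow>
     0 \<le> c2 \<and> c2 \<le> c1 \<and> c1 \<le> 1 \<and>
     (\<forall>\<tau>\<ge>0.
        (\<forall>u. \<tau> \<le> \<bar>u\<bar> \<longrightarrow> f \<tau> (- u) = - f \<tau> u) \<and>
        (\<forall>u v. \<tau> \<le> u \<and> u < v \<longrightarrow> f \<tau> u < f \<tau> v) \<and>
        (\<forall>u\<ge>\<tau>. u - c1 * \<tau> \<le> f \<tau> u \<and> f \<tau> u \<le> u - c2 * \<tau>))"

text \<open>\<open>I\<close> is a set of \<open>k\<close> largest components of \<open>z\<close> in magnitude and \<open>j\<close> is the index of a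
  \<open>(k+1)\<close>-th largest one. Ties may be broken in any way.\<close>

definition largest_indices :: "nat \<Rightarrow> real ^ 'n \<Rightarrow> 'n set \<Rightarrow> 'n \<Rightarrow> bool" where
  "largest_indices k z I j \<longleftrightarrow>
     card I = k \<and> (\<forall>i\<in>I. \<forall>l. l \<notin> I \<longrightarrow> \<bar>z $ l\<bar> \<le> \<bar>z $ i\<bar>) \<and>
     j \<notin> I \<and> (\<forall>l. l \<notin> I \<longrightarrow> \<bar>z $ l\<bar> \<le> \<bar>z $ j\<bar>)"

definition AIT_step ::
  "real ^ 'n ^ 'm \<Rightarrow> real ^ 'm \<Rightarrow> (real \<Rightarrow> real \<Rightarrow> real) \<Rightarrow> nat \<Rightarrow> real
     \<Rightarrow> real ^ 'n \<Rightarrow> real ^ 'n \<Rightarrow> bool" where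
  "AIT_step A b f k s x x' \<longleftrightarrow>
     (\<exists>z I j. z = x - s *\<^sub>R (transpose A *v (A *v x - b)) \<and>
        largest_indices k z I j \<and>
        x' = (\<chi> i. if i \<in> I then f \<bar>z $ j\<bar> (z $ i) else 0))"

definition AIT_sequence ::
  "real ^ 'n ^ 'm \<Rightarrow> real ^ 'm \<Rightarrow> (real \<Rightarrow> real \<Rightarrow> real) \<Rightarrow> nat \<Rightarrow> real
     \<Rightarrow> (nat \<Rightarrow> real ^ 'n) \<Rightarrow> bool" where
  "AIT_sequence A b f k s x \<longleftrightarrow> (\<forall>t. AIT_step A b f k s (x t) (x (Suc t)))"

text \<open>Below, \<open>K\<close> is the sparsity of the target vector. Division in \<^typ>\<open>ereal\<close> provides the
  conventions \<open>1/\<infinity> = 0\<close> and \<open>p/\<infinity> = 0\<close>.\<close>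

definition AIT_L1 :: "real \<Rightarrow> ereal \<Rightarrow> nat \<Rightarrow> real \<Rightarrow> real" where
  "AIT_L1 p q K c2 =
     2 powr (p - 1) * real K powr (max (1 - real_of_ereal (ereal p / q)) 0)
     + (2 powr (p - 1) - c2 powr p + 1) * real K"

definition AIT_L2 :: "real \<Rightarrow> ereal \<Rightarrow> nat \<Rightarrow> real \<Rightarrow> real" where
  "AIT_L2 p q K c1 =
     2 powr p * real (2 * K) powr (max (1 - real_of_ereal (ereal p / q)) 0)
     + 2 powr (p - 1) * c1 powr p * real K"

definition AIT_L :: "real \<Rightarrow> ereal \<Rightarrow> nat \<Rightarrow> real \<Rightarrow> real \<Rightarrow> real" where
  "AIT_L p q K c1 c2 = min (AIT_L1 p q K c2 powr (1 / p)) (AIT_L2 p q K c1 powr (1 / p))"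

definition AIT_D :: "real \<Rightarrow> ereal \<Rightarrow> nat \<Rightarrow> real" where
  "AIT_D p q K = real (2 * K) powr (max (real_of_ereal (1 / q) - 1 / p) 0)"

definition AIT_s_lower :: "real \<Rightarrow> ereal \<Rightarrow> nat \<Rightarrow> real \<Rightarrow> real \<Rightarrow> real" where
  "AIT_s_lower p q K L \<beta> = (AIT_D p q K - 1 / L) / (AIT_D p q K - \<beta>)"

definition AIT_s_upper :: "real \<Rightarrow> ereal \<Rightarrow> nat \<Rightarrow> real \<Rightarrow> real \<Rightarrow> real" where
  "AIT_s_upper p q K L \<beta> = (AIT_D p q K + 1 / L) / (AIT_D p q K + \<beta>)"

definition AIT_gamma :: "real \<Rightarrow> ereal \<Rightarrow> nat \<Rightarrow> real \<Rightarrow> real \<Rightarrow> real" where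
  "AIT_gamma p q K \<beta> s = \<bar>1 - s\<bar> * AIT_D p q K + s * \<beta>"

end

theory Submission
  imports Defs
begin

text \<open>
  Write \<open>v = x\<^sup>t - x\<^sup>*\<close> for the current error, \<open>S\<close> for the support of the target \<open>x\<^sup>*\<close>, \<open>I\<close> for
  the index set chosen in the next step, and \<open>j\<close> for the index that supplies the threshold
  \<open>\<tau> = \<bar>z\<^sub>j\<bar>\<close>. One step of the algorithm multiplies the error by at most \<open>\<rho> = \<gamma> L\<close>, up to noise; the
  two factors come from its two halves.

  The gradient step gives \<open>z - x\<^sup>* = (1 - s) v + s (v - A\<^sup>T A v) + s A\<^sup>T \<epsilon>\<close>. On \<open>T = I \<union> S \<union> {j}\<close> the
  middle term is controlled by the restricted isometry constant, because \<open>T\<close> together with the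
  support of \<open>v\<close> has at most \<open>3 k\<^sup>* + 1\<close> elements, and the first one by comparing the \<open>\<ell>\<^sub>q\<close> and \<open>\<ell>\<^sub>p\<close>
  norms of a vector with at most \<open>2 k\<^sup>*\<close> nonzero entries. This is \<open>gradient_step_error\<close>, with factor
  \<open>\<gamma>\<close>. For \<open>p = 1\<close>, \<open>q = \<infinity>\<close> the first iterate may be dense; then the constant bounds every entry of
  \<open>I - A\<^sup>T A\<close>, which is enough for an \<open>\<ell>\<^sub>1\<close>-to-\<open>\<ell>\<^sub>\<infinity>\<close> bound on all vectors
  (\<open>lp_norm_on_residual_le_dense\<close>).

  The thresholding step turns an \<open>\<ell>\<^sub>q\<close> bound \<open>M\<close> on \<open>w = z - x\<^sup>*\<close> over \<open>T\<close> into an \<open>\<ell>\<^sub>p\<close> bound \<open>L M\<close>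
  on the new error (\<open>thresholding_error\<close>). What makes this work is \<open>\<tau> \<le> M\<close>: the \<open>k\<^sup>* + 1\<close> indices of
  \<open>I \<union> {j}\<close> cannot all lie in \<open>S\<close>, and at an index outside \<open>S\<close> the entry of \<open>z\<close>, which has modulus
  at least \<open>\<tau>\<close>, is an entry of \<open>w\<close>. Every entry of the new error is then an entry of \<open>w\<close> perturbed
  by at most \<open>\<tau>\<close>, and \<open>L\<^sub>1\<close>, \<open>L\<^sub>2\<close> are two ways of adding up their \<open>p\<close>-th powers.

  Finally, the bounds on \<open>s\<close> are \<open>\<gamma> < 1 / L\<close> solved for \<open>s\<close> (\<open>AIT_rate_less_1\<close>), and iterating the
  one-step inequality sums a geometric series (\<open>affine_recursion_bound\<close>).
\<close>

section \<open>Inequalities for powers\<close>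

text \<open>Convexity on the open half-line extends to the endpoint 0 because \<open>t powr p \<le> t\<close> for \<open>t \<in> [0, 1]\<close>.\<close>

lemma convex_on_powr_nonneg:
  fixes p :: real
  assumes "1 \<le> p"
  shows "convex_on {0..} (\<lambda>x. x powr p)"
proof (rule convex_on_linorderI)
  fix t x y :: real
  assume t: "0 < t" "t < 1" and xy: "x \<in> {0..}" "y \<in> {0..}" "x < y"
  show "((1 - t) *\<^sub>R x + t *\<^sub>R y) powr p \<le> (1 - t) * x powr p + t * y powr p"
  proof (cases "x = 0")
    case True
    have "t powr p \<le> t"
      using t assms by (intro powr_le_one_le) auto
    then have "t powr p * y powr p \<le> t * y powr p"
      by (intro mult_right_mono) auto
    then show ?thesis
      using True t xy by (simp add: powr_mult)
  next
    case False
    then show ?thesis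
      using convex_onD[OF powr_convex[OF assms], of t x y] t xy by auto
  qed
qed simp

text \<open>Convexity of the power at the midpoint of \<open>a\<close> and \<open>b\<close>.\<close>

lemma powr_add_le:
  fixes a b p :: real
  assumes "1 \<le> p" "0 \<le> a" "0 \<le> b"
  shows "(a + b) powr p \<le> 2 powr (p - 1) * (a powr p + b powr p)"
proof -
  have "((a + b) / 2) powr p \<le> (a powr p + b powr p) / 2"
    using convex_onD[OF convex_on_powr_nonneg[OF assms(1)], of "1/2" a b] assms
    by (simp add: field_simps)
  moreover have "((a + b) / 2) powr p = (a + b) powr p / (2 * 2 powr (p - 1))"
    using assms by (simp add: powr_divide powr_diff)
  ultimately show ?thesis by (simp add: field_simps)
qed

text \<open>Dividing by \<open>a + b\<close> reduces the claim to \<open>u powr p \<le> u\<close> for \<open>u \<in> [0, 1]\<close>.\<close>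

lemma powr_superadditive:
  fixes a b p :: real
  assumes "1 \<le> p" "0 \<le> a" "0 \<le> b"
  shows "a powr p + b powr p \<le> (a + b) powr p"
proof (cases "a + b = 0")
  case False
  then have pos: "0 < a + b" using assms by auto
  have le: "u powr p \<le> u / (a + b) * (a + b) powr p" if "0 \<le> u" "u \<le> a + b" for u
  proof -
    have "(u / (a + b)) powr p \<le> u / (a + b)"
      using that pos assms(1) by (cases "u = 0") (auto intro!: powr_le_one_le)
    then have "(u / (a + b)) powr p * (a + b) powr p \<le> u / (a + b) * (a + b) powr p"
      by (intro mult_right_mono) auto
    then show ?thesis
      using that pos by (simp add: powr_divide)
  qed
  have "a powr p + b powr p \<le> a / (a + b) * (a + b) powr p + b / (a + b) * (a + b) powr p"
    using le[of a] le[of b] assms by auto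
  also have "\<dots> = (a + b) powr p"
    using pos by (metis add_divide_distrib distrib_right div_self less_irrefl mult_1)
  finally show ?thesis .
next
  case True
  then have "a = 0" "b = 0" using assms by auto
  then show ?thesis by simp
qed

section \<open>The \<open>\<ell>\<^sub>q\<close> norms\<close>

lemma lp_norm_on_nonneg [simp]: "finite S \<Longrightarrow> 0 \<le> lp_norm_on q S v"
  by (simp add: lp_norm_on_def)

lemma lp_norm_on_inf_le_iff:
  assumes "finite S"
  shows "lp_norm_on \<infinity> S v \<le> c \<longleftrightarrow> 0 \<le> c \<and> (\<forall>i\<in>S. \<bar>v i\<bar> \<le> c)"
  using assms by (simp add: lp_norm_on_def)

lemma lp_norm_on_powr:
  assumes "1 \<le> p" 
  shows "lp_norm_on (ereal p) S v powr p = (\<Sum>i\<in>S. \<bar>v i\<bar> powr p)"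
  using assms by (simp add: lp_norm_on_def powr_powr sum_nonneg)

text \<open>Membership in the scaled unit ball, without the outer root. Normalizing by a
  norm and passing through this form reduces inequalities between norms to inequalities between
  single entries.\<close>

lemma lp_norm_on_le_iff:
  assumes "1 \<le> p" "0 < c"
  shows "lp_norm_on (ereal p) S v \<le> c \<longleftrightarrow> (\<Sum>i\<in>S. (\<bar>v i\<bar> / c) powr p) \<le> 1"
proof -
  let ?s = "\<Sum>i\<in>S. \<bar>v i\<bar> powr p"
  have s: "0 \<le> ?s" by (simp add: sum_nonneg)
  have "(\<Sum>i\<in>S. (\<bar>v i\<bar> / c) powr p) = ?s / c powr p"
    using assms by (simp add: powr_divide sum_divide_distrib)
  moreover have "?s powr (1 / p) \<le> c \<longleftrightarrow> ?s \<le> c powr p"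
  proof
    assume "?s powr (1 / p) \<le> c"
    then have "(?s powr (1 / p)) powr p \<le> c powr p"
      using assms by (intro powr_mono2) auto
    then show "?s \<le> c powr p" using assms s by (simp add: powr_powr)
  next
    assume "?s \<le> c powr p"
    then have "?s powr (1 / p) \<le> (c powr p) powr (1 / p)"
      using assms s by (intro powr_mono2) auto
    then show "?s powr (1 / p) \<le> c" using assms by (simp add: powr_powr)
  qed
  ultimately show ?thesis
    using assms by (simp add: lp_norm_on_def)
qed

lemma exponent_cases:
  fixes q :: ereal
  assumes "1 \<le> q"
  obtains "q = \<infinity>" | r where "q = ereal r" "1 \<le> r"
  using assms by (cases q) auto

lemma abs_le_lp_norm_on:
  assumes "1 \<le> q" "finite S" "i \<in> S"
  shows "\<bar>v i\<bar> \<le> lp_norm_on q S v"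
  using \<open>1 \<le> q\<close>
proof (cases rule: exponent_cases)
  case 1
  then show ?thesis
    using assms lp_norm_on_inf_le_iff[of S v "lp_norm_on q S v"] by simp
next
  case (2 r)
  have "\<bar>v i\<bar> powr r \<le> (\<Sum>i\<in>S. \<bar>v i\<bar> powr r)"
    using assms by (intro member_le_sum) auto
  then have "(\<bar>v i\<bar> powr r) powr (1 / r) \<le> (\<Sum>i\<in>S. \<bar>v i\<bar> powr r) powr (1 / r)"
    using 2 by (intro powr_mono2) auto
  then show ?thesis using 2 by (simp add: lp_norm_on_def powr_powr)
qed

lemma lp_norm_on_eq_0:
  assumes "1 \<le> q" "\<And>i. i \<in> S \<Longrightarrow> v i = 0" "finite S"
  shows "lp_norm_on q S v = 0"
  using \<open>1 \<le> q\<close>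
proof (cases rule: exponent_cases)
  case 1
  then show ?thesis
    using assms lp_norm_on_inf_le_iff[of S v 0] lp_norm_on_nonneg[of S q v]
    by (intro antisym) auto
qed (use assms in \<open>simp add: lp_norm_on_def\<close>)

text \<open>The two index sets need not be nested: entries at which \<open>v\<close> vanishes may be
  dropped, so that the norm of a sparse vector can be moved freely between sets containing its
  support.\<close>

lemma lp_norm_on_mono:
  assumes "1 \<le> q" "finite T" and le: "\<And>i. i \<in> S \<Longrightarrow> v i \<noteq> 0 \<Longrightarrow> i \<in> T \<and> \<bar>v i\<bar> \<le> \<bar>w i\<bar>"
    and "finite S"
  shows "lp_norm_on q S v \<le> lp_norm_on q T w"
  using \<open>1 \<le> q\<close>
proof (cases rule: exponent_cases)
  case 1
  have "\<bar>v i\<bar> \<le> lp_norm_on q T w" if "i \<in> S" for i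
    using that le abs_le_lp_norm_on[OF assms(1,2), of i w] assms(2)
    by (cases "v i = 0") force+
  then show ?thesis
    using assms 1 by (simp add: lp_norm_on_inf_le_iff)
next
  case (2 r)
  have "(\<Sum>i\<in>S. \<bar>v i\<bar> powr r) = (\<Sum>i\<in>S \<inter> T. \<bar>v i\<bar> powr r)"
    using assms(4) le by (intro sum.mono_neutral_right) auto
  also have "\<dots> \<le> (\<Sum>i\<in>S \<inter> T. \<bar>w i\<bar> powr r)"
    using le 2 by (intro sum_mono powr_mono2) fastforce+
  also have "\<dots> \<le> (\<Sum>i\<in>T. \<bar>w i\<bar> powr r)"
    using assms(2) by (intro sum_mono2) auto
  finally show ?thesis
    using 2 by (simp add: lp_norm_on_def powr_mono2 sum_nonneg)
qed

lemma lp_norm_on_scale: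
  assumes "1 \<le> q" "finite S"
  shows "lp_norm_on q S (\<lambda>i. c * v i) \<le> \<bar>c\<bar> * lp_norm_on q S v"
  using \<open>1 \<le> q\<close>
proof (cases rule: exponent_cases)
  case 1
  then show ?thesis
    using assms abs_le_lp_norm_on[OF assms, of _ v]
    by (simp add: lp_norm_on_inf_le_iff abs_mult mult_left_mono)
next
  case (2 r)
  then show ?thesis
    by (simp add: lp_norm_on_def abs_mult powr_mult powr_powr flip: sum_distrib_left)
qed

text \<open>Minkowski's inequality. With \<open>a\<close>, \<open>b\<close> the norms of \<open>u\<close>, \<open>v\<close>, the vector
  \<open>(u + v) / (a + b)\<close> is entrywise dominated by a convex combination of \<open>\<bar>u\<bar> / a\<close> and \<open>\<bar>v\<bar> / b\<close>, both
  in the unit ball, so convexity of the power puts it there as well.\<close>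

lemma lp_norm_on_triangle:
  assumes "1 \<le> q" "finite S"
  shows "lp_norm_on q S (\<lambda>i. u i + v i) \<le> lp_norm_on q S u + lp_norm_on q S v"
proof -
  define a b where ab: "a = lp_norm_on q S u" "b = lp_norm_on q S v"
  have u: "\<bar>u i\<bar> \<le> a" and v: "\<bar>v i\<bar> \<le> b" if "i \<in> S" for i
    using that assms by (simp_all add: abs_le_lp_norm_on ab)
  have "0 \<le> a" "0 \<le> b" using assms by (simp_all add: ab)
  then consider "a = 0" | "b = 0" | "0 < a" "0 < b" by force
  then have "lp_norm_on q S (\<lambda>i. u i + v i) \<le> a + b"
  proof cases
    case 1
    then have "lp_norm_on q S (\<lambda>i. u i + v i) \<le> b"
      unfolding ab(2) using assms u 1 by (intro lp_norm_on_mono) fastforce+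
    then show ?thesis using 1 by simp
  next
    case 2
    then have "lp_norm_on q S (\<lambda>i. u i + v i) \<le> a"
      unfolding ab(1) using assms v 2 by (intro lp_norm_on_mono) fastforce+
    then show ?thesis using 2 by simp
  next
    case 3
    show ?thesis
      using \<open>1 \<le> q\<close>
    proof (cases rule: exponent_cases)
      case 1
      then show ?thesis
        using 3 u v assms by (force simp: lp_norm_on_inf_le_iff)
    next
      case (2 r)
      define t where "t = b / (a + b)"
      have t: "0 \<le> t" "t \<le> 1" using 3 by (auto simp: t_def)
      have pt: "(\<bar>u i + v i\<bar> / (a + b)) powr r
          \<le> (1 - t) * (\<bar>u i\<bar> / a) powr r + t * (\<bar>v i\<bar> / b) powr r" for i
      proof -
        have "\<bar>u i + v i\<bar> / (a + b) \<le> (\<bar>u i\<bar> + \<bar>v i\<bar>) / (a + b)"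
          using 3 by (intro divide_right_mono) auto
        also have "\<dots> = (1 - t) * (\<bar>u i\<bar> / a) + t * (\<bar>v i\<bar> / b)"
        proof -
          have "1 - t = a / (a + b)" using 3 by (simp add: t_def field_simps)
          then show ?thesis using 3 by (simp add: t_def add_divide_distrib)
        qed
        finally have "(\<bar>u i + v i\<bar> / (a + b)) powr r
            \<le> ((1 - t) * (\<bar>u i\<bar> / a) + t * (\<bar>v i\<bar> / b)) powr r"
          using 3 2 by (intro powr_mono2) auto
        also have "\<dots> \<le> (1 - t) * (\<bar>u i\<bar> / a) powr r + t * (\<bar>v i\<bar> / b) powr r"
          using convex_onD[OF convex_on_powr_nonneg[OF 2(2)] t, of "\<bar>u i\<bar> / a" "\<bar>v i\<bar> / b"] 3
          by simp
        finally show ?thesis .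
      qed
      have "(\<Sum>i\<in>S. (\<bar>u i + v i\<bar> / (a + b)) powr r)
          \<le> (1 - t) * (\<Sum>i\<in>S. (\<bar>u i\<bar> / a) powr r) + t * (\<Sum>i\<in>S. (\<bar>v i\<bar> / b) powr r)"
        unfolding sum_distrib_left sum.distrib[symmetric] by (intro sum_mono pt)
      also have "\<dots> \<le> (1 - t) * 1 + t * 1"
        using t 3 2 ab lp_norm_on_le_iff[OF 2(2), of a S u] lp_norm_on_le_iff[OF 2(2), of b S v]
        by (intro add_mono mult_left_mono) auto
      finally show ?thesis
        using 3 2 by (simp add: lp_norm_on_le_iff)
    qed
  qed
  then show ?thesis by (simp add: ab)
qed

text \<open>Entries of a vector of \<open>\<ell>\<^sub>p\<close> norm 1 lie in \<open>[0, 1]\<close> in absolute value,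
  and there raising the exponent lowers the power.\<close>

lemma lp_norm_on_antimono_exponent:
  assumes "1 \<le> p" "p \<le> q" "finite S"
  shows "lp_norm_on q S v \<le> lp_norm_on p S v"
proof -
  define c where "c = lp_norm_on p S v"
  have v: "\<bar>v i\<bar> \<le> c" if "i \<in> S" for i
    using that assms by (simp add: abs_le_lp_norm_on c_def)
  have "0 \<le> c" using assms by (simp add: c_def)
  have q: "1 \<le> q" using assms by auto
  have "lp_norm_on q S v \<le> c"
  proof (cases "c = 0")
    case True
    then show ?thesis
      using v lp_norm_on_eq_0[of q S v] q assms by auto
  next
    case False
    then have c: "0 < c" using \<open>0 \<le> c\<close> by simp
    from q show ?thesis
    proof (cases rule: exponent_cases)
      case 1
      then show ?thesis using v c assms by (simp add: lp_norm_on_inf_le_iff)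
    next
      case (2 r)
      then obtain r' where r': "p = ereal r'" "1 \<le> r'" "r' \<le> r"
        using assms by (cases p) auto
      have "(\<Sum>i\<in>S. (\<bar>v i\<bar> / c) powr r) \<le> (\<Sum>i\<in>S. (\<bar>v i\<bar> / c) powr r')"
        using v c r' by (intro sum_mono powr_mono') auto
      also have "\<dots> \<le> 1"
        using lp_norm_on_le_iff[OF r'(2) c, of S v] r' by (simp add: c_def)
      finally show ?thesis using 2 c by (simp add: lp_norm_on_le_iff)
    qed
  qed
  then show ?thesis by (simp add: c_def)
qed

text \<open>The power mean inequality, that is Jensen's inequality for the power \<open>p / q\<close> and
  uniform weights on \<open>S\<close>.\<close>

lemma lp_norm_on_le_card:
  assumes q: "1 \<le> q" and qp: "q \<le> p" and S: "finite S" "card S \<le> N"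
  shows "lp_norm_on q S v
    \<le> real N powr (real_of_ereal (1 / q) - real_of_ereal (1 / p)) * lp_norm_on p S v"
proof (cases "S = {}")
  case True
  then have "lp_norm_on q S v = 0" using q by (intro lp_norm_on_eq_0) auto
  then show ?thesis using S by simp
next
  case False
  have p: "1 \<le> p" using q qp by auto
  define n where "n = real (card S)"
  have n: "1 \<le> n" "n \<le> real N"
    using False S by (simp_all add: n_def Suc_le_eq card_gt_0_iff)
  define c where "c = lp_norm_on p S v"
  have c: "0 \<le> c" using S by (simp add: c_def)
  have v: "\<bar>v i\<bar> \<le> c" if "i \<in> S" for i
    using that p S by (simp add: abs_le_lp_norm_on c_def)
  from q show ?thesis
  proof (cases rule: exponent_cases)
    case 1
    then have "p = \<infinity>" using qp by auto
    then show ?thesis using 1 n by simp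
  next
    case q': (2 q')
    from p have "lp_norm_on q S v \<le> n powr (1 / q' - real_of_ereal (1 / p)) * c"
    proof (cases rule: exponent_cases)
      case 1
      have "(\<Sum>i\<in>S. \<bar>v i\<bar> powr q') \<le> n * c powr q'"
        unfolding n_def using v q' by (intro sum_bounded_above powr_mono2) auto
      then have "(\<Sum>i\<in>S. \<bar>v i\<bar> powr q') powr (1 / q') \<le> (n * c powr q') powr (1 / q')"
        using q' by (intro powr_mono2) (auto intro: sum_nonneg)
      then show ?thesis
        using 1 q' c n by (simp add: lp_norm_on_def powr_mult powr_powr)
    next
      case (2 p')
      define y where "y = (\<Sum>i\<in>S. (1 / n) * \<bar>v i\<bar> powr q')"
      have r: "1 \<le> p' / q'" using 2 q' qp by auto
      have y0: "0 \<le> y" unfolding y_def using n by (intro sum_nonneg) auto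
      have "y powr (p' / q') \<le> (\<Sum>i\<in>S. (1 / n) * (\<bar>v i\<bar> powr q') powr (p' / q'))"
        using convex_on_sum[OF S(1) False convex_on_powr_nonneg[OF r], of "\<lambda>_. 1 / n" "\<lambda>i. \<bar>v i\<bar> powr q'"] n
        by (simp add: y_def n_def)
      also have "\<dots> = (1 / n) * c powr p'"
        using q' 2 by (simp add: powr_powr c_def lp_norm_on_powr sum_divide_distrib)
      finally have "(y powr (p' / q')) powr (1 / p') \<le> ((1 / n) * c powr p') powr (1 / p')"
        using 2 by (intro powr_mono2) auto
      then have "y powr (1 / q') \<le> n powr (- 1 / p') * c"
        using 2 n c by (simp add: powr_powr powr_mult powr_divide powr_minus_divide)
      then have "n powr (1 / q') * y powr (1 / q') \<le> n powr (1 / q') * (n powr (- 1 / p') * c)"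
        by (intro mult_left_mono) auto
      moreover have "n powr (1 / q') * y powr (1 / q') = (n * y) powr (1 / q')"
        using n y0 by (simp add: powr_mult)
      moreover have "n * y = (\<Sum>i\<in>S. \<bar>v i\<bar> powr q')"
        using n by (simp add: y_def flip: sum_divide_distrib)
      ultimately show ?thesis
        using 2 q' by (simp add: lp_norm_on_def powr_diff powr_minus_divide one_ereal_def)
    qed
    also have "\<dots> \<le> real N powr (1 / q' - real_of_ereal (1 / p)) * c"
    proof -
      have "0 \<le> 1 / q' - real_of_ereal (1 / p)"
        using p q' qp by (cases rule: exponent_cases) (auto simp: frac_le one_ereal_def)
      then show ?thesis
        using n c by (intro mult_right_mono powr_mono2) auto
    qed
    finally show ?thesis using q' by (simp add: c_def one_ereal_def)
  qed
qed

text \<open>The two preceding comparisons in one: the maximum in the exponent selects the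
  one that applies. This is the power occurring in \<open>D\<close>.\<close>

lemma lp_norm_on_le_card_max:
  assumes "1 \<le> q" "1 \<le> p" "finite S" "card S \<le> N" "1 \<le> N"
  shows "lp_norm_on q S v
    \<le> real N powr max (real_of_ereal (1 / q) - real_of_ereal (1 / p)) 0 * lp_norm_on p S v"
    (is "_ \<le> real N powr max ?d 0 * _")
proof (cases "q \<le> p")
  case True
  have "real N powr ?d \<le> real N powr max ?d 0"
    using assms by (intro powr_mono) auto
  then have "real N powr ?d * lp_norm_on p S v \<le> real N powr max ?d 0 * lp_norm_on p S v"
    using assms by (intro mult_right_mono) auto
  then show ?thesis
    using lp_norm_on_le_card[OF assms(1) True assms(3,4), of v] by linarith
next
  case False
  have "1 \<le> real N powr max ?d 0"
    using assms by (intro ge_one_powr_ge_zero) auto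
  then have "1 * lp_norm_on p S v \<le> real N powr max ?d 0 * lp_norm_on p S v"
    using assms by (intro mult_right_mono) auto
  then show ?thesis
    using lp_norm_on_antimono_exponent[of p q S v] False assms by (smt (verit) linear)
qed

text \<open>The \<open>p\<close>-th power of the preceding comparison with the roles of \<open>p\<close> and \<open>q\<close>
  exchanged, which is the form in which it enters \<open>L\<^sub>1\<close> and \<open>L\<^sub>2\<close>.\<close>

lemma sum_powr_le_card:
  assumes "1 \<le> p" "1 \<le> q" "finite T" "B \<subseteq> T" "card B \<le> N" "1 \<le> N"
  shows "(\<Sum>i\<in>B. \<bar>v i\<bar> powr p)
    \<le> real N powr max (1 - real_of_ereal (ereal p / q)) 0 * lp_norm_on q T v powr p"
proof -
  define d where "d = max (1 / p - real_of_ereal (1 / q)) 0"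
  have B: "finite B" using assms finite_subset by blast
  have "lp_norm_on p B v \<le> real N powr d * lp_norm_on q B v"
    using lp_norm_on_le_card_max[of "ereal p" q B N v] assms B
    by (simp add: d_def one_ereal_def)
  also have "\<dots> \<le> real N powr d * lp_norm_on q T v"
    using assms B by (intro mult_left_mono lp_norm_on_mono) auto
  finally have "lp_norm_on p B v powr p \<le> (real N powr d * lp_norm_on q T v) powr p"
    using assms B by (intro powr_mono2) auto
  also have "\<dots> = real N powr (d * p) * lp_norm_on q T v powr p"
    using assms by (simp add: powr_mult powr_powr)
  also have "d * p = max (1 - real_of_ereal (ereal p / q)) 0"
  proof -
    from assms(2) have "1 - real_of_ereal (ereal p / q) = (1 / p - real_of_ereal (1 / q)) * p"
      using assms(1) by (cases rule: exponent_cases) (auto simp: field_simps one_ereal_def)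
    then show ?thesis
      using assms(1) by (simp add: d_def max_mult_distrib_right)
  qed
  finally show ?thesis using assms by (simp add: lp_norm_on_powr)
qed

section \<open>The generalized restricted isometry constant\<close>

text \<open>Any finite bound suffices here: it makes the supremum in the definition of
  the constant an actual upper bound. All norms on a finite-dimensional space being equivalent, the
  crude estimate through the \<open>\<ell>\<^sub>1\<close> norm is good enough.\<close>

lemma lp_norm_on_residual_bounded:
  fixes A :: "real ^ 'n ^ 'm"
  assumes "1 \<le> p" "1 \<le> q"
  obtains C where "\<And>S x. lp_norm_on q S (\<lambda>i. x i - submat_transpose_mult A (submat_mult A S x) i)
                     \<le> C * lp_norm_on (ereal p) S x"
proof
  fix S :: "'n set" and x :: "'n \<Rightarrow> real"
  define D where "D = (\<Sum>j\<in>UNIV. norm (column j A))"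
  define a where "a = lp_norm_on (ereal p) S x"
  have x: "\<bar>x i\<bar> \<le> a" if "i \<in> S" for i
    using that assms by (simp add: a_def abs_le_lp_norm_on)
  have a: "0 \<le> a" by (simp add: a_def)
  have col: "norm (column j A) \<le> D" for j
    unfolding D_def by (intro member_le_sum) auto
  then have D: "0 \<le> D" by (meson norm_ge_zero order_trans)
  let ?r = "\<lambda>i. x i - submat_transpose_mult A (submat_mult A S x) i"
  have "norm (submat_mult A S x) \<le> (\<Sum>j\<in>S. \<bar>x j\<bar> * norm (column j A))"
    unfolding submat_mult_def by (rule order_trans[OF norm_sum]) simp
  also have "\<dots> \<le> (\<Sum>j\<in>S. a * norm (column j A))"
    using x by (intro sum_mono mult_right_mono) auto
  also have "\<dots> \<le> a * D"
    unfolding D_def sum_distrib_left using a by (intro sum_mono2) auto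
  finally have Ax: "norm (submat_mult A S x) \<le> a * D" .
  have r: "\<bar>?r i\<bar> \<le> a + D * (a * D)" if "i \<in> S" for i
  proof -
    have "\<bar>submat_transpose_mult A (submat_mult A S x) i\<bar> \<le> D * (a * D)"
      unfolding submat_transpose_mult_def
      by (rule order_trans[OF Cauchy_Schwarz_ineq2]) (intro mult_mono col Ax D norm_ge_zero)
    then show ?thesis using x[OF that] by linarith
  qed
  have "lp_norm_on q S ?r \<le> lp_norm_on (ereal 1) S ?r"
    using assms by (intro lp_norm_on_antimono_exponent) (auto simp: one_ereal_def)
  also have "\<dots> = (\<Sum>i\<in>S. \<bar>?r i\<bar>)"
    by (simp add: lp_norm_on_def sum_nonneg)
  also have "\<dots> \<le> (\<Sum>i\<in>S. a + D * (a * D))"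
    by (intro sum_mono r)
  also have "\<dots> \<le> (\<Sum>i\<in>(UNIV :: 'n set). a + D * (a * D))"
    using a D by (intro sum_mono2) auto
  also have "\<dots> = (real CARD('n) * (1 + D * D)) * a"
    by (simp add: algebra_simps)
  finally show "lp_norm_on q S ?r
      \<le> (real CARD('n) * (1 + (\<Sum>j\<in>UNIV. norm (column j A)) * (\<Sum>j\<in>UNIV. norm (column j A))))
        * lp_norm_on (ereal p) S x"
    by (simp add: D_def a_def)
qed

lemma lp_norm_on_pos:
  assumes "1 \<le> q" "finite S" "i \<in> S" "v i \<noteq> 0"
  shows "0 < lp_norm_on q S v"
  using abs_le_lp_norm_on[OF assms(1-3), of v] assms(4) by linarith

lemma gRIC_set_bdd_above:
  assumes "1 \<le> p" "1 \<le> q"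
  shows "bdd_above {lp_norm_on q S (\<lambda>i. x i - submat_transpose_mult A (submat_mult A S x) i)
            / lp_norm_on (ereal p) S x | S x. card S \<le> r \<and> (\<exists>i\<in>S. x i \<noteq> 0)}"
proof -
  obtain C where C: "\<And>S x. lp_norm_on q S (\<lambda>i. x i - submat_transpose_mult A (submat_mult A S x) i)
                     \<le> C * lp_norm_on (ereal p) S x"
    using lp_norm_on_residual_bounded[OF assms, where A = A] by blast
  show ?thesis
  proof (intro bdd_aboveI[of _ C], safe)
    fix S :: "'a set" and x :: "'a \<Rightarrow> real" and i
    assume "i \<in> S" "x i \<noteq> 0"
    then have "0 < lp_norm_on (ereal p) S x"
      using assms by (intro lp_norm_on_pos) auto
    then show "lp_norm_on q S (\<lambda>i. x i - submat_transpose_mult A (submat_mult A S x) i)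
            / lp_norm_on (ereal p) S x \<le> C"
      using C[of S x] by (simp add: divide_le_eq)
  qed
qed

lemma lp_norm_on_residual_le_gRIC:
  assumes "1 \<le> p" "1 \<le> q" "card S \<le> r"
  shows "lp_norm_on q S (\<lambda>i. x i - submat_transpose_mult A (submat_mult A S x) i)
    \<le> gRIC A r p q * lp_norm_on (ereal p) S x"
proof (cases "\<exists>i\<in>S. x i \<noteq> 0")
  case True
  then have "lp_norm_on q S (\<lambda>i. x i - submat_transpose_mult A (submat_mult A S x) i)
            / lp_norm_on (ereal p) S x \<le> gRIC A r p q"
    unfolding gRIC_def using assms by (intro cSup_upper gRIC_set_bdd_above) auto
  moreover have "0 < lp_norm_on (ereal p) S x"
    using True assms by (auto intro: lp_norm_on_pos)
  ultimately show ?thesis by (simp add: divide_le_eq)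
next
  case False
  then have "submat_mult A S x = 0" by (simp add: submat_mult_def)
  then show ?thesis
    using False assms by (simp add: lp_norm_on_eq_0 submat_transpose_mult_def)
qed

lemma gRIC_nonneg:
  fixes A :: "real ^ 'n ^ 'm"
  assumes "1 \<le> p" "1 \<le> q" "1 \<le> r"
  shows "0 \<le> gRIC A r p q"
proof -
  let ?one = "\<lambda>_. 1 :: real"
  have "0 \<le> lp_norm_on q {undefined :: 'n} (\<lambda>i. ?one i - submat_transpose_mult A (submat_mult A {undefined :: 'n} ?one) i)"
    by simp
  also have "\<dots> \<le> gRIC A r p q * lp_norm_on (ereal p) {undefined :: 'n} ?one"
    using lp_norm_on_residual_le_gRIC[OF assms(1,2), of "{undefined :: 'n}" r ?one A] assms by simp
  finally show ?thesis by (simp add: lp_norm_on_def)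
qed

lemma matrix_vector_mult_eq_submat_mult:
  assumes "{i. v $ i \<noteq> 0} \<subseteq> S"
  shows "A *v v = submat_mult A S (\<lambda>i. v $ i)"
  unfolding matrix_mult_sum submat_mult_def scalar_mult_eq_scaleR
  using assms by (intro sum.mono_neutral_right) auto

lemma transpose_mult_eq_submat_transpose_mult:
  "(transpose A *v y) $ i = submat_transpose_mult A y i"
  by (simp add: submat_transpose_mult_def matrix_mult_dot inner_vec_def column_def transpose_def)

text \<open>The constant sees only one index set, for the entries of \<open>v\<close> as well as for
  those of the residual. So \<open>T\<close> is enlarged by the support of \<open>v\<close>, which makes \<open>A v\<close> the product
  with a submatrix.\<close>

lemma lp_norm_on_residual_le_sparse:
  assumes "1 \<le> p" "1 \<le> q" "card (T \<union> {i. v $ i \<noteq> 0}) \<le> r"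
  shows "lp_norm_on q T (\<lambda>i. (v - transpose A *v (A *v v)) $ i) \<le> gRIC A r p q * lp_norm (ereal p) v"
proof -
  let ?U = "T \<union> {i. v $ i \<noteq> 0}"
  have "lp_norm_on q T (\<lambda>i. (v - transpose A *v (A *v v)) $ i)
      \<le> lp_norm_on q ?U (\<lambda>i. (v - transpose A *v (A *v v)) $ i)"
    using assms by (intro lp_norm_on_mono) auto
  also have "\<dots> \<le> gRIC A r p q * lp_norm_on (ereal p) ?U (\<lambda>i. v $ i)"
    using lp_norm_on_residual_le_gRIC[OF assms, of "\<lambda>i. v $ i" A]
    by (simp only: matrix_vector_mult_eq_submat_mult[of v ?U A] vector_minus_component
        transpose_mult_eq_submat_transpose_mult Un_upper2)
  also have "lp_norm_on (ereal p) ?U (\<lambda>i. v $ i) = lp_norm (ereal p) v"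
    unfolding lp_norm_def using assms by (intro antisym lp_norm_on_mono) auto
  finally show ?thesis .
qed

text \<open>Restricting to a pair \<open>{i, j}\<close> and testing with the \<open>j\<close>-th unit vector
  shows that the constant bounds the \<open>(i, j)\<close> entry of \<open>I - A\<^sup>T A\<close>. The operator norm from \<open>\<ell>\<^sub>1\<close> to
  \<open>\<ell>\<^sub>\<infinity>\<close> is the largest entry, so \<open>v\<close> may have any support.\<close>

lemma lp_norm_on_residual_le_dense:
  assumes r: "2 \<le> r"
  shows "lp_norm_on \<infinity> T (\<lambda>i. (v - transpose A *v (A *v v)) $ i) \<le> gRIC A r 1 \<infinity> * lp_norm 1 v"
proof -
  define g where "g = gRIC A r 1 \<infinity>"
  have g0: "0 \<le> g" unfolding g_def using r by (intro gRIC_nonneg) auto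
  have entry: "\<bar>(if i = j then 1 else 0) - column i A \<bullet> column j A\<bar> \<le> g" for i j
  proof -
    let ?e = "\<lambda>l. if l = j then 1 else 0 :: real"
    let ?S = "{i, j}"
    have sm: "submat_mult A ?S ?e = column j A"
      by (simp add: submat_mult_def if_distrib[of "\<lambda>c. c *\<^sub>R _"] cong: if_cong)
    have "\<bar>?e i - submat_transpose_mult A (submat_mult A ?S ?e) i\<bar>
        \<le> lp_norm_on \<infinity> ?S (\<lambda>i. ?e i - submat_transpose_mult A (submat_mult A ?S ?e) i)"
      by (rule abs_le_lp_norm_on) auto
    also have "\<dots> \<le> g * lp_norm_on (ereal 1) ?S ?e"
      unfolding g_def using r by (intro lp_norm_on_residual_le_gRIC) (auto simp: card_insert_if)
    also have "lp_norm_on (ereal 1) ?S ?e = 1"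
      by (cases "i = j") (auto simp: lp_norm_on_def)
    finally show ?thesis by (simp add: sm submat_transpose_mult_def)
  qed
  have "\<bar>(v - transpose A *v (A *v v)) $ i\<bar> \<le> g * lp_norm 1 v" for i
  proof -
    have "(transpose A *v (A *v v)) $ i = (\<Sum>j\<in>UNIV. v $ j * (column i A \<bullet> column j A))"
      unfolding transpose_mult_eq_submat_transpose_mult submat_transpose_mult_def
        matrix_vector_mult_eq_submat_mult[of v UNIV A, OF subset_UNIV] submat_mult_def
      by (simp add: inner_sum_right)
    moreover have "v $ i = (\<Sum>j\<in>UNIV. v $ j * (if i = j then 1 else 0))"
      by (simp add: if_distrib cong: if_cong)
    ultimately have "(v - transpose A *v (A *v v)) $ i
        = (\<Sum>j\<in>UNIV. v $ j * ((if i = j then 1 else 0) - column i A \<bullet> column j A))"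
      by (simp add: right_diff_distrib sum_subtractf)
    also have "\<bar>\<dots>\<bar> \<le> (\<Sum>j\<in>UNIV. \<bar>v $ j\<bar> * g)"
      by (rule order_trans[OF sum_abs]) (auto intro!: sum_mono mult_left_mono entry simp: abs_mult)
    also have "\<dots> = g * lp_norm 1 v"
      by (simp add: lp_norm_def lp_norm_on_def one_ereal_def sum_nonneg sum_distrib_left mult.commute)
    finally show ?thesis .
  qed
  then show ?thesis
    using g0 by (simp add: lp_norm_on_inf_le_iff lp_norm_def flip: g_def)
qed

section \<open>The gradient step\<close>

text \<open>Sparsity of \<open>v = x - x\<^sup>*\<close> enters twice, in the isometry bound for \<open>v - A\<^sup>T A v\<close>
  and in the comparison of the \<open>\<ell>\<^sub>q\<close> norm of \<open>v\<close> with its \<open>\<ell>\<^sub>p\<close> norm. For the pair \<open>(1, \<infinity>)\<close> the entrywise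
  bound on \<open>I - A\<^sup>T A\<close> and the inequality between the \<open>\<ell>\<^sub>\<infinity>\<close> and the \<open>\<ell>\<^sub>1\<close> norm take its place.\<close>

lemma gradient_step_error:
  assumes "1 \<le> p" "1 \<le> q" "0 \<le> s" "1 \<le> K"
    and z: "z = x - s *\<^sub>R (transpose A *v (A *v x - (A *v xstar + \<epsilon>)))"
    and supp: "p = 1 \<and> q = \<infinity> \<and> 2 \<le> r
      \<or> card (T \<union> {i. (x - xstar) $ i \<noteq> 0}) \<le> r \<and> card {i. (x - xstar) $ i \<noteq> 0} \<le> 2 * K"
  shows "lp_norm_on q T (\<lambda>i. (z - xstar) $ i)
    \<le> AIT_gamma p q K (gRIC A r p q) s * lp_norm (ereal p) (x - xstar)
      + s * lp_norm q (transpose A *v \<epsilon>)"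
proof -
  define v where "v = x - xstar"
  let ?R = "\<lambda>i. (v - transpose A *v (A *v v)) $ i"
  let ?E = "\<lambda>i. (transpose A *v \<epsilon>) $ i"
  have "z - xstar = (1 - s) *\<^sub>R v + (s *\<^sub>R (v - transpose A *v (A *v v)) + s *\<^sub>R (transpose A *v \<epsilon>))"
    by (simp add: z v_def algebra_simps matrix_vector_mult_diff_distrib)
  then have zeq: "(\<lambda>i. (z - xstar) $ i) = (\<lambda>i. (1 - s) * v $ i + (s * ?R i + s * ?E i))"
    by (simp only: vector_add_component vector_scaleR_component real_scaleR_def)
  have "lp_norm_on q T (\<lambda>i. (z - xstar) $ i)
      \<le> lp_norm_on q T (\<lambda>i. (1 - s) * v $ i) + lp_norm_on q T (\<lambda>i. s * ?R i + s * ?E i)"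
    unfolding zeq using assms by (intro lp_norm_on_triangle) auto
  moreover have "lp_norm_on q T (\<lambda>i. s * ?R i + s * ?E i)
      \<le> lp_norm_on q T (\<lambda>i. s * ?R i) + lp_norm_on q T (\<lambda>i. s * ?E i)"
    using assms by (intro lp_norm_on_triangle) auto
  moreover have "lp_norm_on q T (\<lambda>i. (1 - s) * v $ i) \<le> \<bar>1 - s\<bar> * lp_norm_on q T (\<lambda>i. v $ i)"
    using assms by (intro lp_norm_on_scale) auto
  moreover have "lp_norm_on q T (\<lambda>i. s * ?R i) \<le> s * lp_norm_on q T ?R"
    using lp_norm_on_scale[OF assms(2), of T s ?R] assms(3) by simp
  moreover have "lp_norm_on q T (\<lambda>i. s * ?E i) \<le> s * lp_norm_on q T ?E"
    using lp_norm_on_scale[OF assms(2), of T s ?E] assms(3) by simp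
  moreover have "s * lp_norm_on q T ?E \<le> s * lp_norm q (transpose A *v \<epsilon>)"
    unfolding lp_norm_def using assms by (intro mult_left_mono lp_norm_on_mono) auto
  moreover have "lp_norm_on q T ?R \<le> gRIC A r p q * lp_norm (ereal p) v"
    using supp lp_norm_on_residual_le_sparse[OF assms(1,2), of T v r A]
      lp_norm_on_residual_le_dense[of r T v A] by (auto simp: v_def one_ereal_def)
  then have "s * lp_norm_on q T ?R \<le> s * (gRIC A r p q * lp_norm (ereal p) v)"
    using assms(3) by (rule mult_left_mono)
  moreover have "lp_norm_on q T (\<lambda>i. v $ i) \<le> AIT_D p q K * lp_norm (ereal p) v"
  proof (cases "p = 1 \<and> q = \<infinity>")
    case True
    have "lp_norm_on \<infinity> T (\<lambda>i. v $ i) \<le> lp_norm_on \<infinity> UNIV (\<lambda>i. v $ i)"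
      by (intro lp_norm_on_mono) auto
    also have "\<dots> \<le> lp_norm 1 v"
      unfolding lp_norm_def by (intro lp_norm_on_antimono_exponent) auto
    finally show ?thesis using True assms by (simp add: AIT_D_def one_ereal_def)
  next
    case False
    let ?U = "{i. v $ i \<noteq> 0}"
    have "lp_norm_on q T (\<lambda>i. v $ i) \<le> lp_norm_on q ?U (\<lambda>i. v $ i)"
      using assms by (intro lp_norm_on_mono) auto
    also have "\<dots> \<le> AIT_D p q K * lp_norm_on (ereal p) ?U (\<lambda>i. v $ i)"
      using lp_norm_on_le_card_max[of q "ereal p" ?U "2 * K" "\<lambda>i. v $ i"] supp assms False
      by (auto simp: AIT_D_def v_def one_ereal_def)
    also have "\<dots> \<le> AIT_D p q K * lp_norm (ereal p) v"
      unfolding lp_norm_def AIT_D_def using assms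
      by (intro mult_left_mono lp_norm_on_mono) auto
    finally show ?thesis .
  qed
  then have "\<bar>1 - s\<bar> * lp_norm_on q T (\<lambda>i. v $ i) \<le> \<bar>1 - s\<bar> * (AIT_D p q K * lp_norm (ereal p) v)"
    by (rule mult_left_mono) simp
  ultimately have "lp_norm_on q T (\<lambda>i. (z - xstar) $ i)
      \<le> \<bar>1 - s\<bar> * (AIT_D p q K * lp_norm (ereal p) v)
        + s * (gRIC A r p q * lp_norm (ereal p) v) + s * lp_norm q (transpose A *v \<epsilon>)"
    by linarith
  then show ?thesis
    by (simp add: AIT_gamma_def v_def algebra_simps)
qed

section \<open>The thresholding step\<close>

text \<open>Since \<open>f\<^sub>\<tau>\<close> is odd it suffices to look at \<open>\<bar>u\<bar>\<close>. There the lower bound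
  \<open>\<bar>u\<bar> - c\<^sub>1 \<tau>\<close> is nonnegative, so the upper bound \<open>\<bar>u\<bar> - c\<^sub>2 \<tau>\<close> also bounds the modulus.\<close>

lemma defining_function_bounds:
  assumes f: "defining_function f c1 c2" and u: "0 \<le> \<tau>" "\<tau> \<le> \<bar>u\<bar>"
  shows "\<bar>f \<tau> u - u\<bar> \<le> c1 * \<tau>" "\<bar>f \<tau> u\<bar> \<le> \<bar>u\<bar> - c2 * \<tau>" "c2 * \<tau> \<le> \<tau>"
proof -
  have c: "0 \<le> c2" "c2 \<le> 1" "c1 \<le> 1" and odd: "f \<tau> (- u) = - f \<tau> u"
    and bd: "\<bar>u\<bar> - c1 * \<tau> \<le> f \<tau> \<bar>u\<bar>" "f \<tau> \<bar>u\<bar> \<le> \<bar>u\<bar> - c2 * \<tau>"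
    using f u by (auto simp: defining_function_def)
  have le: "c1 * \<tau> \<le> \<tau>" "0 \<le> c2 * \<tau>" and c2: "c2 * \<tau> \<le> \<tau>"
    using c u mult_right_mono[of c1 1 \<tau>] mult_right_mono[of c2 1 \<tau>] by auto
  show "\<bar>f \<tau> u - u\<bar> \<le> c1 * \<tau>" "\<bar>f \<tau> u\<bar> \<le> \<bar>u\<bar> - c2 * \<tau>" "c2 * \<tau> \<le> \<tau>"
    using bd le c2 u odd by (cases "0 \<le> u"; simp)+
qed

lemma AIT_L1_ge_1:
  assumes "1 \<le> p" "1 \<le> K" "0 \<le> c2" "c2 \<le> 1"
  shows "1 \<le> AIT_L1 p q K c2"
proof -
  have a: "1 \<le> (2::real) powr (p - 1)" using assms by (intro ge_one_powr_ge_zero) auto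
  have b: "1 \<le> real K powr max (1 - real_of_ereal (ereal p / q)) 0"
    using assms by (intro ge_one_powr_ge_zero) auto
  have "c2 powr p \<le> 1" using assms by (intro powr_le1) auto
  then have "0 \<le> (2 powr (p - 1) - c2 powr p + 1) * real K"
    using a by (intro mult_nonneg_nonneg) auto
  moreover have "1 * 1 \<le> (2::real) powr (p - 1) * real K powr max (1 - real_of_ereal (ereal p / q)) 0"
    using a b by (intro mult_mono) auto
  ultimately show ?thesis unfolding AIT_L1_def by linarith
qed

lemma AIT_L2_ge_1:
  assumes "1 \<le> p" "1 \<le> K"
  shows "1 \<le> AIT_L2 p q K c1"
proof -
  have a: "1 \<le> (2::real) powr p" using assms by (intro ge_one_powr_ge_zero) auto
  have b: "1 \<le> real (2 * K) powr max (1 - real_of_ereal (ereal p / q)) 0"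
    using assms by (intro ge_one_powr_ge_zero) auto
  have "1 * 1 \<le> (2::real) powr p * real (2 * K) powr max (1 - real_of_ereal (ereal p / q)) 0"
    using a b by (intro mult_mono) auto
  moreover have "0 \<le> 2 powr (p - 1) * c1 powr p * real K" by simp
  ultimately show ?thesis unfolding AIT_L2_def by linarith
qed

text \<open>With \<open>L \<ge> 1\<close>, the assumption \<open>\<beta> < 1 / L\<close> forces \<open>\<beta> < 1 \<le> D\<close>, so that the
  denominator of the lower bound on the step size is positive.\<close>

lemma AIT_L_ge_1:
  assumes "1 \<le> p" "1 \<le> K" "0 \<le> c2" "c2 \<le> 1"
  shows "1 \<le> AIT_L p q K c1 c2"
  using assms AIT_L1_ge_1[OF assms] AIT_L2_ge_1[OF assms(1,2)]
  by (auto simp: AIT_L_def intro!: ge_one_powr_ge_zero)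

text \<open>An index of \<open>I\<close> contributes at most \<open>\<bar>w\<^sub>i\<bar> + c\<^sub>1 \<tau>\<close> to the new error (a kept
  entry), and an index of \<open>S - I\<close> at most \<open>\<bar>w\<^sub>i\<bar> + \<tau>\<close> (a missed entry, where \<open>\<bar>z\<^sub>i\<bar> \<le> \<tau>\<close>). For a
  spurious index, one of \<open>I - S\<close>, the target vanishes, hence \<open>\<bar>w\<^sub>i\<bar> = \<bar>z\<^sub>i\<bar> \<ge> \<tau>\<close> and thresholding only
  shrinks the error, to at most \<open>\<bar>w\<^sub>i\<bar> - c\<^sub>2 \<tau>\<close>.

  Both bounds exploit that \<open>I\<close> and \<open>S\<close> have the same size, so there are as many spurious as
  missed indices. For \<open>L\<^sub>1\<close> the gain \<open>c\<^sub>2 \<tau>\<close> at each spurious index is kept. For \<open>L\<^sub>2\<close> the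
  powers of \<open>\<tau>\<close> at the missed indices are instead paid for by the entries of \<open>w\<close> at the spurious
  ones.\<close>

lemma thresholding_error_powr:
  fixes z xs :: "real ^ 'n"
  assumes p: "1 \<le> p" and q: "1 \<le> q" and K: "l0_norm xs = K" "1 \<le> K"
    and f: "defining_function f c1 c2" and li: "largest_indices K z I j"
  defines "x' \<equiv> \<chi> i. if i \<in> I then f \<bar>z $ j\<bar> (z $ i) else 0"
    and "M \<equiv> lp_norm_on q (I \<union> {i. xs $ i \<noteq> 0} \<union> {j}) (\<lambda>i. (z - xs) $ i)"
  shows "lp_norm (ereal p) (x' - xs) powr p \<le> AIT_L1 p q K c2 * M powr p"
    and "lp_norm (ereal p) (x' - xs) powr p \<le> AIT_L2 p q K c1 * M powr p"
proof -
  define S where "S = {i. xs $ i \<noteq> 0}"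
  define T where "T = I \<union> S \<union> {j}"
  define w where "w = (\<lambda>i. (z - xs) $ i)"
  define \<tau> where "\<tau> = \<bar>z $ j\<bar>"
  define n where "n = card (I - S)"
  define W where "W = (\<lambda>B. \<Sum>i\<in>B. \<bar>w i\<bar> powr p)"
  define err where "err = (\<lambda>B. \<Sum>i\<in>B. \<bar>(x' - xs) $ i\<bar> powr p)"
  define C where "C = (2::real) powr (p - 1)"
  have cS: "card S = K" using K by (simp add: S_def l0_norm_def)
  have I: "card I = K" "j \<notin> I" "\<And>i. i \<in> I \<Longrightarrow> \<tau> \<le> \<bar>z $ i\<bar>" "\<And>i. i \<notin> I \<Longrightarrow> \<bar>z $ i\<bar> \<le> \<tau>"
    using li by (auto simp: largest_indices_def \<tau>_def)
  have M: "M = lp_norm_on q T w" by (simp add: M_def T_def S_def w_def)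
  have M0: "0 \<le> M" by (simp add: M)
  have wM: "\<bar>w i\<bar> \<le> M" if "i \<in> T" for i
    using that q by (simp add: M abs_le_lp_norm_on)
  have \<tau>0: "0 \<le> \<tau>" by (simp add: \<tau>_def)
  have c: "0 \<le> c2" "c2 \<le> 1" "0 \<le> c1" using f by (auto simp: defining_function_def)
  have C1: "1 \<le> C" unfolding C_def using p by (intro ge_one_powr_ge_zero) auto

  have wI: "\<bar>w i\<bar> = \<bar>z $ i\<bar>" if "i \<notin> S" for i
    using that by (simp add: w_def S_def)
  \<comment> \<open>Some index of \<open>I \<union> {j}\<close> lies outside \<open>S\<close>, and there \<open>z\<close> and \<open>w\<close> agree in modulus.\<close>
  have \<tau>M: "\<tau> \<le> M"
  proof -
    have "\<not> I \<union> {j} \<subseteq> S"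
    proof
      assume "I \<union> {j} \<subseteq> S"
      then have "card (I \<union> {j}) \<le> card S" by (intro card_mono) auto
      then show False using I cS by simp
    qed
    then obtain l where l: "l \<in> I \<union> {j}" "l \<notin> S" by blast
    then have "\<tau> \<le> \<bar>z $ l\<bar>" using I by (auto simp: \<tau>_def)
    then show ?thesis using wI[OF l(2)] wM[of l] l by (auto simp: T_def)
  qed
  have \<tau>Mp: "\<tau> powr p \<le> M powr p" using \<tau>M \<tau>0 p by (intro powr_mono2) auto

  have n': "card (S - I) = n" and nK: "card (I \<inter> S) + n = K" "n \<le> K"
  proof -
    have "card (I \<inter> S) + card (I - S) = card I" "card (S \<inter> I) + card (S - I) = card S"
      by (simp_all only: card_Int_Diff[OF finite, symmetric])
    then show "card (S - I) = n" "card (I \<inter> S) + n = K" "n \<le> K"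
      using I(1) cS by (auto simp: n_def Int_commute)
  qed

  have kept: "\<bar>(x' - xs) $ i\<bar> powr p \<le> C * (\<bar>w i\<bar> powr p + c1 powr p * \<tau> powr p)" if "i \<in> I" for i
  proof -
    have "\<bar>(x' - xs) $ i\<bar> \<le> \<bar>w i\<bar> + c1 * \<tau>"
      using defining_function_bounds(1)[OF f \<tau>0 I(3)[OF that]] that
      by (simp add: x'_def w_def \<tau>_def)
    then have "\<bar>(x' - xs) $ i\<bar> powr p \<le> (\<bar>w i\<bar> + c1 * \<tau>) powr p"
      using p by (intro powr_mono2) auto
    also have "\<dots> \<le> C * (\<bar>w i\<bar> powr p + (c1 * \<tau>) powr p)"
      unfolding C_def using p c \<tau>0 by (intro powr_add_le) auto
    finally show ?thesis using c \<tau>0 by (simp add: powr_mult)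
  qed
  have missed: "\<bar>(x' - xs) $ i\<bar> powr p \<le> C * (\<bar>w i\<bar> powr p + \<tau> powr p)" if "i \<notin> I" for i
  proof -
    have "\<bar>(x' - xs) $ i\<bar> \<le> \<bar>w i\<bar> + \<tau>"
      using I(4)[OF that] that by (simp add: x'_def w_def)
    then have "\<bar>(x' - xs) $ i\<bar> powr p \<le> (\<bar>w i\<bar> + \<tau>) powr p"
      using p by (intro powr_mono2) auto
    also have "\<dots> \<le> C * (\<bar>w i\<bar> powr p + \<tau> powr p)"
      unfolding C_def using p \<tau>0 by (intro powr_add_le) auto
    finally show ?thesis .
  qed
  have spurious: "\<bar>(x' - xs) $ i\<bar> powr p \<le> \<bar>w i\<bar> powr p - c2 powr p * \<tau> powr p"
    if i: "i \<in> I - S" for i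
  proof -
    have le: "\<tau> \<le> \<bar>z $ i\<bar>" using i I by auto
    note b = defining_function_bounds(2,3)[OF f \<tau>0 le]
    have "\<bar>(x' - xs) $ i\<bar> \<le> \<bar>w i\<bar> - c2 * \<tau>"
      using b i by (simp add: x'_def w_def S_def \<tau>_def)
    then have "\<bar>(x' - xs) $ i\<bar> powr p \<le> (\<bar>w i\<bar> - c2 * \<tau>) powr p"
      using p by (intro powr_mono2) auto
    also have "\<dots> \<le> \<bar>w i\<bar> powr p - (c2 * \<tau>) powr p"
      using powr_superadditive[OF p, of "\<bar>w i\<bar> - c2 * \<tau>" "c2 * \<tau>"] c \<tau>0 b(2) le wI[of i] i
      by auto
    finally show ?thesis using c \<tau>0 by (simp add: powr_mult)
  qed

  have split: "lp_norm (ereal p) (x' - xs) powr p = err (I \<inter> S) + err (I - S) + err (S - I)"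
  proof -
    have "lp_norm (ereal p) (x' - xs) powr p = err (I \<union> S)"
      unfolding lp_norm_def lp_norm_on_powr[OF p] err_def
      by (intro sum.mono_neutral_right) (auto simp: x'_def S_def)
    also have "I \<union> S = (I \<inter> S) \<union> (I - S) \<union> (S - I)" by auto
    also have "err \<dots> = err (I \<inter> S) + err (I - S) + err (S - I)"
      unfolding err_def by (subst sum.union_disjoint, auto)+
    finally show ?thesis .
  qed
  have WS: "W (I \<inter> S) + W (S - I) = W S"
    unfolding W_def by (subst sum.union_disjoint[symmetric]) (auto intro: sum.cong)
  have WI: "W (I \<inter> S) + W (I - S) = W I"
    unfolding W_def by (subst sum.union_disjoint[symmetric]) (auto intro: sum.cong)
  have WIS: "W I + W (S - I) = W (I \<union> S)"
    unfolding W_def by (subst sum.union_disjoint[symmetric]) (auto intro: sum.cong)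
  have W0: "0 \<le> W B" for B by (simp add: W_def sum_nonneg)
  have err_missed: "err (S - I) \<le> C * (W (S - I) + real n * \<tau> powr p)"
  proof -
    have "err (S - I) \<le> (\<Sum>i\<in>S - I. C * (\<bar>w i\<bar> powr p + \<tau> powr p))"
      unfolding err_def by (intro sum_mono missed) auto
    then show ?thesis by (simp add: W_def n' sum.distrib flip: sum_distrib_left)
  qed

  show "lp_norm (ereal p) (x' - xs) powr p \<le> AIT_L1 p q K c2 * M powr p"
  proof -
    have c1p: "c1 powr p \<le> 1" using f p by (intro powr_le1) (auto simp: defining_function_def)
    have c2p: "c2 powr p \<le> 1" using c p by (intro powr_le1) auto
    have "err (I \<inter> S) \<le> (\<Sum>i\<in>I \<inter> S. C * (\<bar>w i\<bar> powr p + \<tau> powr p))"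
      unfolding err_def
    proof (intro sum_mono)
      fix i assume "i \<in> I \<inter> S"
      then have "\<bar>(x' - xs) $ i\<bar> powr p \<le> C * (\<bar>w i\<bar> powr p + c1 powr p * \<tau> powr p)"
        by (intro kept) auto
      also have "\<dots> \<le> C * (\<bar>w i\<bar> powr p + 1 * \<tau> powr p)"
        using c1p C1 by (intro mult_left_mono add_left_mono mult_right_mono) auto
      finally show "\<bar>(x' - xs) $ i\<bar> powr p \<le> C * (\<bar>w i\<bar> powr p + \<tau> powr p)" by simp
    qed
    then have e1: "err (I \<inter> S) \<le> C * (W (I \<inter> S) + real (card (I \<inter> S)) * \<tau> powr p)"
      by (simp add: W_def sum.distrib flip: sum_distrib_left)
    have "err (I - S) \<le> (\<Sum>i\<in>I - S. \<bar>w i\<bar> powr p - c2 powr p * \<tau> powr p)"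
      unfolding err_def by (intro sum_mono spurious)
    then have e2: "err (I - S) \<le> W (I - S) - real n * (c2 powr p * \<tau> powr p)"
      by (simp add: W_def n_def sum_subtractf)
    have e3: "W (I - S) \<le> real n * M powr p"
      unfolding W_def n_def using p
      by (intro sum_bounded_above powr_mono2 wM) (auto simp: T_def)
    have e4: "W S \<le> real K powr max (1 - real_of_ereal (ereal p / q)) 0 * M powr p"
      unfolding W_def M using p q cS K(2) by (intro sum_powr_le_card) (auto simp: T_def)
    \<comment> \<open>The coefficient of \<open>\<tau> powr p\<close> below is nonnegative, so \<open>\<tau>\<close> may be replaced by \<open>M\<close>.\<close>
    have nKC: "real n * c2 powr p \<le> C * real K"
      using mult_mono[of "real n" "real K" "c2 powr p" C] nK(2) C1 c2p by (simp add: mult.commute)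
    have kn: "real (card (I \<inter> S)) + real n = real K" using nK(1) by linarith
    have "lp_norm (ereal p) (x' - xs) powr p
        \<le> C * W S + C * (real (card (I \<inter> S)) + real n) * \<tau> powr p
           + W (I - S) - real n * (c2 powr p * \<tau> powr p)"
      unfolding split WS[symmetric] using e1 e2 err_missed by (simp add: algebra_simps)
    also have "\<dots> = C * W S + (C * real K - real n * c2 powr p) * \<tau> powr p + W (I - S)"
      unfolding kn by (simp add: algebra_simps)
    also have "\<dots> \<le> C * (real K powr max (1 - real_of_ereal (ereal p / q)) 0 * M powr p)
        + (C * real K - real n * c2 powr p) * M powr p + real n * M powr p"
      using e3 e4 C1 nKC \<tau>Mp by (intro add_mono mult_left_mono) auto
    also have "\<dots> = (C * real K powr max (1 - real_of_ereal (ereal p / q)) 0 + C * real K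
        + real n * (1 - c2 powr p)) * M powr p"
      by (simp add: algebra_simps)
    also have "\<dots> \<le> (C * real K powr max (1 - real_of_ereal (ereal p / q)) 0 + C * real K
        + real K * (1 - c2 powr p)) * M powr p"
      using nK(2) c2p by (intro mult_right_mono add_left_mono) auto
    also have "\<dots> = AIT_L1 p q K c2 * M powr p"
      by (simp add: AIT_L1_def C_def algebra_simps)
    finally show ?thesis .
  qed

  show "lp_norm (ereal p) (x' - xs) powr p \<le> AIT_L2 p q K c1 * M powr p"
  proof -
    have "err I \<le> (\<Sum>i\<in>I. C * (\<bar>w i\<bar> powr p + c1 powr p * \<tau> powr p))"
      unfolding err_def by (intro sum_mono kept)
    then have e1: "err I \<le> C * (W I + real K * (c1 powr p * \<tau> powr p))"
      by (simp add: W_def sum.distrib I(1) flip: sum_distrib_left)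
    have "err (I \<inter> S) + err (I - S) = err I"
      unfolding err_def by (subst sum.union_disjoint[symmetric]) (auto intro: sum.cong)
    with split have s2: "lp_norm (ereal p) (x' - xs) powr p = err I + err (S - I)" by simp
    have "real n * \<tau> powr p \<le> W (I - S)"
      unfolding W_def n_def
    proof (rule sum_bounded_below)
      fix i assume "i \<in> I - S"
      then show "\<tau> powr p \<le> \<bar>w i\<bar> powr p"
        using I(3)[of i] wI[of i] \<tau>0 p by (intro powr_mono2) auto
    qed
    also have "\<dots> \<le> W (I \<union> S)" unfolding W_def by (intro sum_mono2) auto
    finally have e2: "real n * \<tau> powr p \<le> W (I \<union> S)" .
    have "card (I \<union> S) \<le> 2 * K" using card_Un_le[of I S] I(1) cS by simp
    then have e3: "W (I \<union> S) \<le> real (2 * K) powr max (1 - real_of_ereal (ereal p / q)) 0 * M powr p"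
      unfolding W_def M using p q K(2) by (intro sum_powr_le_card) (auto simp: T_def)
    have "lp_norm (ereal p) (x' - xs) powr p
        \<le> C * (W (I \<union> S) + real n * \<tau> powr p) + C * c1 powr p * real K * \<tau> powr p"
      unfolding s2 WIS[symmetric] using e1 err_missed by (simp add: algebra_simps)
    also have "\<dots> \<le> C * (2 * W (I \<union> S)) + C * c1 powr p * real K * M powr p"
      using e2 C1 \<tau>Mp by (intro add_mono mult_left_mono) auto
    also have "\<dots> \<le> C * (2 * (real (2 * K) powr max (1 - real_of_ereal (ereal p / q)) 0 * M powr p))
         + C * c1 powr p * real K * M powr p"
      using e3 C1 by (intro add_right_mono mult_left_mono) auto
    also have "\<dots> = AIT_L2 p q K c1 * M powr p"
      by (simp add: AIT_L2_def C_def powr_diff algebra_simps)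
    finally show ?thesis .
  qed
qed

lemma thresholding_error:
  fixes z xs :: "real ^ 'n"
  assumes p: "1 \<le> p" and q: "1 \<le> q" and K: "l0_norm xs = K" "1 \<le> K"
    and f: "defining_function f c1 c2" and li: "largest_indices K z I j"
  shows "lp_norm (ereal p) ((\<chi> i. if i \<in> I then f \<bar>z $ j\<bar> (z $ i) else 0) - xs)
    \<le> AIT_L p q K c1 c2 * lp_norm_on q (I \<union> {i. xs $ i \<noteq> 0} \<union> {j}) (\<lambda>i. (z - xs) $ i)"
    (is "?e \<le> _ * ?M")
proof -
  have root: "?e \<le> B powr (1 / p) * ?M" if "?e powr p \<le> B * ?M powr p" "1 \<le> B" for B
  proof -
    have "(?e powr p) powr (1 / p) \<le> (B * ?M powr p) powr (1 / p)"
      using that p by (intro powr_mono2) auto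
    then show ?thesis
      using p that(2) by (simp add: powr_mult powr_powr lp_norm_def)
  qed
  have c: "0 \<le> c2" "c2 \<le> 1" using f by (auto simp: defining_function_def)
  show ?thesis
    unfolding AIT_L_def min_def
    using root[OF thresholding_error_powr(1)[OF assms] AIT_L1_ge_1[OF p K(2) c]]
      root[OF thresholding_error_powr(2)[OF assms] AIT_L2_ge_1[OF p K(2)]]
    by simp
qed

section \<open>Linear convergence\<close>

lemma largest_indices_support:
  assumes "largest_indices k z I j"
  shows "l0_norm (\<chi> i. if i \<in> I then g i else 0) \<le> k"
proof -
  have "card {i. (\<chi> i. if i \<in> I then g i else 0) $ i \<noteq> 0} \<le> card I"
    by (intro card_mono) auto
  then show ?thesis using assms by (simp add: l0_norm_def largest_indices_def)
qed

text \<open>The lower bound on \<open>s\<close> is used for \<open>s \<le> 1\<close> and the upper one for \<open>s > 1\<close>;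
  in each case the bound is \<open>\<gamma> < 1 / L\<close> solved for \<open>s\<close>.\<close>

lemma AIT_rate_less_1:
  assumes D: "1 \<le> AIT_D p q K" and L: "1 \<le> L" and \<beta>: "0 \<le> \<beta>" "\<beta> < 1 / L"
    and lo: "AIT_s_lower p q K L \<beta> < s" and up: "s < AIT_s_upper p q K L \<beta>"
  shows "AIT_gamma p q K \<beta> s * L < 1"
proof -
  have "1 / L \<le> 1" using L by simp
  then have pos: "0 < AIT_D p q K - \<beta>" "0 < AIT_D p q K + \<beta>" using D \<beta> by linarith+
  have "AIT_D p q K - 1 / L < s * (AIT_D p q K - \<beta>)"
    using lo pos by (simp add: AIT_s_lower_def divide_less_eq)
  moreover have "s * (AIT_D p q K + \<beta>) < AIT_D p q K + 1 / L"
    using up pos by (simp add: AIT_s_upper_def less_divide_eq)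
  ultimately have "AIT_gamma p q K \<beta> s < 1 / L"
    by (cases "s \<le> 1") (simp_all add: AIT_gamma_def algebra_simps)
  then show ?thesis using L by (simp add: field_simps)
qed

text \<open>The offset \<open>d / (1 - \<rho>)\<close> is the fixed point of \<open>u \<mapsto> \<rho> u + d\<close>.\<close>

lemma affine_recursion_bound:
  fixes e :: "nat \<Rightarrow> real"
  assumes step: "\<And>t. e (Suc t) \<le> \<rho> * e t + d" and \<rho>: "0 \<le> \<rho>" "\<rho> < 1" and d: "0 \<le> d"
  shows "e t \<le> \<rho> ^ t * e 0 + d / (1 - \<rho>)"
proof (induction t)
  case 0
  then show ?case using \<rho> d by simp
next
  case (Suc t)
  have "e (Suc t) \<le> \<rho> * (\<rho> ^ t * e 0 + d / (1 - \<rho>)) + d"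
    using step[of t] mult_left_mono[OF Suc \<rho>(1)] by linarith
  also have "\<dots> = \<rho> ^ Suc t * e 0 + d / (1 - \<rho>)"
    using \<rho> by (simp add: field_simps)
  finally show ?case .
qed

lemma conjugate_exponent_1:
  fixes q :: ereal
  assumes "1 / ereal 1 + 1 / q = 1" "1 \<le> q"
  shows "q = \<infinity>"
  using assms(2) by (cases rule: exponent_cases) (use assms(1) in \<open>auto simp: one_ereal_def\<close>)

text \<open>The count behind the order \<open>3 K + 1\<close> of the constant: the supports of \<open>x\<close> and
  of the target, the index set \<open>I\<close>, and the single index \<open>j\<close> that defines the threshold.\<close>

lemma AIT_step_error:
  fixes x x' xstar :: "real ^ 'n"
  assumes p: "1 \<le> p" and q: "1 \<le> q" and K: "l0_norm xstar = K" "1 \<le> K" and s: "0 \<le> s"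
    and f: "defining_function f c1 c2"
    and step: "AIT_step A (A *v xstar + \<epsilon>) f K s x x'"
    and x: "p = 1 \<and> q = \<infinity> \<or> l0_norm x \<le> K"
  defines "L \<equiv> AIT_L p q K c1 c2"
  shows "lp_norm (ereal p) (x' - xstar)
    \<le> AIT_gamma p q K (gRIC A (3 * K + 1) p q) s * L * lp_norm (ereal p) (x - xstar)
      + s * L * lp_norm q (transpose A *v \<epsilon>)"
proof -
  obtain z I j where z: "z = x - s *\<^sub>R (transpose A *v (A *v x - (A *v xstar + \<epsilon>)))"
    and li: "largest_indices K z I j"
    and x': "x' = (\<chi> i. if i \<in> I then f \<bar>z $ j\<bar> (z $ i) else 0)"
    using step by (auto simp: AIT_step_def)
  let ?S = "{i. xstar $ i \<noteq> 0}" and ?X = "{i. x $ i \<noteq> 0}" and ?V = "{i. (x - xstar) $ i \<noteq> 0}"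
  let ?T = "I \<union> ?S \<union> {j}"
  let ?M = "lp_norm_on q ?T (\<lambda>i. (z - xstar) $ i)"
  have "p = 1 \<and> q = \<infinity> \<and> 2 \<le> 3 * K + 1 \<or> card (?T \<union> ?V) \<le> 3 * K + 1 \<and> card ?V \<le> 2 * K"
  proof (cases "p = 1 \<and> q = \<infinity>")
    case False
    then have cX: "card ?X \<le> K" using x by (auto simp: l0_norm_def)
    have cS: "card ?S = K" and cI: "card I = K"
      using K li by (auto simp: l0_norm_def largest_indices_def)
    have "card ?V \<le> card (?X \<union> ?S)" by (intro card_mono) auto
    also have "\<dots> \<le> 2 * K" using card_Un_le[of ?X ?S] cX cS by simp
    finally have V: "card ?V \<le> 2 * K" .
    have "card (?T \<union> ?V) \<le> card (insert j ((?X \<union> ?S) \<union> I))" by (intro card_mono) auto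
    also have "\<dots> \<le> Suc (card ((?X \<union> ?S) \<union> I))" by (rule card_insert_le_m1) simp_all
    also have "\<dots> \<le> 3 * K + 1"
      using card_Un_le[of "?X \<union> ?S" I] card_Un_le[of ?X ?S] cX cS cI by simp
    finally show ?thesis using V by simp
  qed (use K in auto)
  then have M: "?M \<le> AIT_gamma p q K (gRIC A (3 * K + 1) p q) s * lp_norm (ereal p) (x - xstar)
      + s * lp_norm q (transpose A *v \<epsilon>)"
    by (rule gradient_step_error[OF p q s K(2) z])
  have L: "0 \<le> L"
    using AIT_L_ge_1[OF p K(2), of c2 q c1] f by (auto simp: L_def defining_function_def)
  have "lp_norm (ereal p) (x' - xstar) \<le> L * ?M"
    unfolding x' L_def by (rule thresholding_error[OF p q K f li])
  also have "\<dots> \<le> L * (AIT_gamma p q K (gRIC A (3 * K + 1) p q) s * lp_norm (ereal p) (x - xstar)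
      + s * lp_norm q (transpose A *v \<epsilon>))"
    using M L by (rule mult_left_mono)
  finally show ?thesis by (simp add: algebra_simps)
qed

theorem theorem2:
  fixes p :: real and q :: ereal
    and A :: "real ^ 'n ^ 'm"
    and xstar :: "real ^ 'n" and \<epsilon> b :: "real ^ 'm"
    and k kstar :: nat and s c1 c2 :: real
    and f :: "real \<Rightarrow> real \<Rightarrow> real"
    and x :: "nat \<Rightarrow> real ^ 'n"
    and \<beta> L \<rho> :: real
  assumes "1 \<le> p" and "1 \<le> q" and "1 / ereal p + 1 / q = 1"
    and "\<And>j. norm (column j A) = 1"
    and "l0_norm xstar = kstar"
    and "b = A *v xstar + \<epsilon>"
    and "1 \<le> k" and "k < CARD('n)" and "0 < s"
    and "defining_function f c1 c2"
    and "AIT_sequence A b f k s x"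
    and "1 < p \<longrightarrow> l0_norm (x 0) \<le> k"
    and "L = AIT_L p q kstar c1 c2"
    and "\<beta> = gRIC A (3 * kstar + 1) p q"
    and "\<beta> < 1 / L"
    and "k = kstar"
    and "AIT_s_lower p q kstar L \<beta> < s" and "s < AIT_s_upper p q kstar L \<beta>"
    and "\<rho> = AIT_gamma p q kstar \<beta> s * L"
  shows "\<rho> < 1 \<and>
    (\<forall>t. lp_norm (ereal p) (x t - xstar)
          \<le> \<rho> ^ t * lp_norm (ereal p) (xstar - x 0)
             + s * L / (1 - \<rho>) * lp_norm q (transpose A *v \<epsilon>)) \<and>
    (\<epsilon> = 0 \<longrightarrow>
      (\<forall>t. lp_norm (ereal p) (x t - xstar) \<le> \<rho> ^ t * lp_norm (ereal p) (xstar - x 0)))"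
proof -
  note p = assms(1) and q = assms(2) and f = assms(10)
  have K: "l0_norm xstar = kstar" "1 \<le> kstar" using assms by auto
  have c: "0 \<le> c2" "c2 \<le> 1" using f by (auto simp: defining_function_def)
  have L: "1 \<le> L" unfolding assms(13) by (rule AIT_L_ge_1[OF p K(2) c])
  have D: "1 \<le> AIT_D p q kstar"
    unfolding AIT_D_def using K(2) by (intro ge_one_powr_ge_zero) auto
  have \<beta>: "0 \<le> \<beta>" unfolding assms(14) by (rule gRIC_nonneg) (use p q in auto)
  have \<rho>1: "\<rho> < 1"
    unfolding assms(19) by (rule AIT_rate_less_1[OF D L \<beta> assms(15,17,18)])
  have \<rho>0: "0 \<le> \<rho>"
    unfolding assms(19) AIT_gamma_def using \<beta> L D \<open>0 < s\<close> by simp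
  define e where "e = (\<lambda>t. lp_norm (ereal p) (x t - xstar))"
  define \<eta> where "\<eta> = lp_norm q (transpose A *v \<epsilon>)"
  have \<eta>0: "0 \<le> \<eta>" by (simp add: \<eta>_def lp_norm_def)
  have st: "AIT_step A (A *v xstar + \<epsilon>) f kstar s (x t) (x (Suc t))" for t
    using assms(11) by (simp add: AIT_sequence_def assms(6) assms(16))
  have supp: "p = 1 \<and> q = \<infinity> \<or> l0_norm (x t) \<le> kstar" for t
  proof (cases t)
    case 0
    then show ?thesis
      using assms(12,16) p q assms(3) conjugate_exponent_1[of q] by (cases "p = 1") auto
  next
    case (Suc t')
    then show ?thesis
      using st[of t'] by (auto simp: AIT_step_def intro!: disjI2 largest_indices_support)
  qed
  have "e (Suc t) \<le> \<rho> * e t + s * L * \<eta>" for t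
    using AIT_step_error[OF p q K less_imp_le[OF \<open>0 < s\<close>] f st supp]
    by (simp add: e_def \<eta>_def assms(13,14,19))
  then have bound: "e t \<le> \<rho> ^ t * e 0 + s * L * \<eta> / (1 - \<rho>)" for t
    using \<rho>0 \<rho>1 L \<eta>0 \<open>0 < s\<close> by (intro affine_recursion_bound) auto
  have e0: "lp_norm (ereal p) (xstar - x 0) = e 0"
    by (simp add: e_def lp_norm_def lp_norm_on_def abs_minus_commute)
  have "\<eta> = 0" if "\<epsilon> = 0"
    using that q by (simp add: \<eta>_def lp_norm_def lp_norm_on_eq_0)
  then have noiseless: "e t \<le> \<rho> ^ t * e 0" if "\<epsilon> = 0" for t
    using bound[of t] that by simp
  show ?thesis
    using \<rho>1 bound noiseless unfolding e0 by (simp add: e_def \<eta>_def)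
qed

end
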